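(* Let $n=2n_0$ be an even positive integer, let $\mathcal M$ be a weighted $\widetilde{gl}(\infty)$-module generated by a subspace $\mathcal M_0$ such that $\widetilde{gl}^m(\infty)(\mathcal M_0)=\{0\}$ for some $m\in\mathbb N$, and let $\iota\in\mathbb C$ with $\iota\notin\mathbb Z/2$. Then the representation $\sigma^\iota_{\mathcal M}$ of $\widehat{sp}(\vec\ell,\mathbb A)$ on $\mathcal M$ is irreducible if and only if $\mathcal M$ is an irreducible $\widetilde{gl}(\infty)$-module.
   Context: All spaces are over $\mathbb C$; $\mathbb N$ = nonnegative integers; $\overline{1,n}=\{1,\dots,n\}$; $\mathcal Z=\mathbb Z+1/2$; $\mathbb Z/2=\{k/2:k\in\mathbb Z\}$; $\langle\mu\rangle_0=1$, $\langle\mu\rangle_m=\mu(\mu-1)\cdots(\mu-m+1)$. $\partial_t=d/dt$, $\mathbb A=\sum_{i\ge0}\mathbb C[t,t^{-1}]\partial_t^i$, $E_{i,j}$ the $n\times n$ matrix units. $\widehat{gl}(n,\mathbb A)=M_{n\times n}(\mathbb A)\oplus\mathbb C\kappa$ has $\kappa$ central and $$[t^{m_1}\partial_t^{r_1}E_{i_1,j_1},t^{m_2}\partial_t^{r_2}E_{i_2,j_2}]=\delta_{j_1,i_2}t^{m_1}\partial_t^{r_1}\cdot t^{m_2}\partial_t^{r_2}E_{i_1,j_2}-\delta_{i_1,j_2}t^{m_2}\partial_t^{r_2}\cdot t^{m_1}\partial_t^{r_1}E_{i_2,j_1}+(-1)^{r_1}\delta_{i_1,j_2}\delta_{j_1,i_2}\delta_{r_1+r_2,m_1+m_2}r_1!r_2!\binom{m_1}{r_1+r_2+1}\kappa.$$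 Put $i^*=n+1-i$; $p(i)=0$ and $p(n_0+i)=1$ for $i\in\overline{1,n_0}$; fix $\epsilon\in\{0,1\}$ and $\vec\ell\in\mathbb N^n$ with $\ell_i\in2\mathbb N+\epsilon$ and $\ell_i=\ell_{i^*}$ for all $i$. $\widehat{sp}(\vec\ell,\mathbb A)$ is the Lie subalgebra of $\widehat{gl}(n,\mathbb A)$ spanned by $\kappa$ and all $t^m\partial_t^{r+\ell_j}E_{i,j}-(-1)^{p(i)+p(j)+\epsilon}(-\partial_t)^rt^m\partial_t^{\ell_i}E_{j^*,i^*}$ ($i,j\in\overline{1,n}$, $r\in\mathbb N$, $m\in\mathbb Z$). $\overline{gl}(\infty)$ has basis $\{\mathcal E_{l,k}\mid l,k\in\mathcal Z\}$ with $\mathcal E_{l_1,l_2}\mathcal E_{k_1,k_2}=\delta_{l_2+k_1,0}\mathcal E_{l_1,k_2}$; $\widetilde{gl}(\infty)=\overline{gl}(\infty)\oplus\mathbb C\kappa_0$ with $\kappa_0$ central and $$[\mathcal E_{l_1,l_2},\mathcal E_{k_1,k_2}]=\mathcal E_{l_1,l_2}\mathcal E_{k_1,k_2}-\mathcal E_{k_1,k_2}\mathcal E_{l_1,l_2}+\delta_{l_1+k_2,0}\delta_{l_2+k_1,0}[H(l_1)H(l_2)-H(k_1)H(k_2)]\kappa_0,$$ $H(l)=1$ for $l>0$, $0$ for $l<0$. $\mathcal T=\sum_{l\in\mathcal Z}\mathbb C\mathcal E_{l,-l}+\mathbb C\kappa_0$; a module is weighted if it is the direct sum of its $\mathcal T$-weight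 spaces. $\widetilde{gl}^m(\infty)=\mathrm{Span}\{\mathcal E_{l_1,-l_2},\mathcal E_{-l_1,l_2}\mid l_1,l_2\in\mathcal Z,\ l_1,l_2>m\}$. $\sigma^\iota_{\mathcal M}$ is the restriction to $\widehat{sp}(\vec\ell,\mathbb A)$ of the representation of $\widehat{gl}(n,\mathbb A)$ on $\mathcal M$ given by $\kappa\mapsto\kappa_0$ and $$t^m\partial_t^rE_{i,j}\mapsto\sum_{l\in\mathbb Z}\langle\iota-l\rangle_r\,\mathcal E_{(m-r-l)n+i-1/2,\,ln-j+1/2}+r!\,\delta_{i,j}\delta_{r,m}\Im_{0,r}\,\kappa_0\qquad(m\in\mathbb Z,\ r\in\mathbb N),$$ where $\sum_{r_1,r_2\ge0}\Im_{r_1,r_2}x^{r_1}y^{r_2}z^{-r_1-r_2-1}=\frac1{x-y}\bigl((\frac{z+y}{z+x})^\iota-1\bigr)$, expanded in nonnegative powers of $x,y$. *)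

theory Defs
  imports
    "HOL-Library.Poly_Mapping"
    "HOL-Library.FuncSet"
    "HOL-Computational_Algebra.Computational_Algebra"
begin

section \<open>The complex vector space with a given basis\<close>

text \<open>
  \<open>'b \<Rightarrow>\<^sub>0 complex\<close> is the vector space with basis \<open>'b\<close>; the basis vector \<open>b\<close> is
  \<open>bvec b\<close>.
\<close>

definition bvec :: "'b \<Rightarrow> ('b \<Rightarrow>\<^sub>0 complex)" where
  "bvec b = Poly_Mapping.single b 1"

definition fscale :: "complex \<Rightarrow> ('b \<Rightarrow>\<^sub>0 complex) \<Rightarrow> ('b \<Rightarrow>\<^sub>0 complex)" where
  "fscale c x = Poly_Mapping.map ((*) c) x"

definition lin_ext ::
    "(complex \<Rightarrow> 'v::ab_group_add \<Rightarrow> 'v) \<Rightarrow> ('b \<Rightarrow> 'v) \<Rightarrow> ('b \<Rightarrow>\<^sub>0 complex) \<Rightarrow> 'v" where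
  "lin_ext scale f x = (\<Sum>b\<in>Poly_Mapping.keys x. scale (Poly_Mapping.lookup x b) (f b))"

definition bilin_ext ::
    "(complex \<Rightarrow> 'v::ab_group_add \<Rightarrow> 'v) \<Rightarrow> ('b \<Rightarrow> 'c \<Rightarrow> 'v) \<Rightarrow>
      ('b \<Rightarrow>\<^sub>0 complex) \<Rightarrow> ('c \<Rightarrow>\<^sub>0 complex) \<Rightarrow> 'v" where
  "bilin_ext scale f x y = lin_ext scale (\<lambda>b. lin_ext scale (f b) y) x"

lemma lookup_fscale [simp]: "Poly_Mapping.lookup (fscale c x) b = c * Poly_Mapping.lookup x b"
  by (simp add: fscale_def Poly_Mapping.map.rep_eq when_def)

lemma vector_space_fscale: "vector_space fscale"
  by unfold_locales (rule poly_mapping_eqI; simp add: lookup_add algebra_simps)+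


section \<open>Modules over a Lie algebra\<close>

definition lie_module ::
    "(('b \<Rightarrow>\<^sub>0 complex) \<Rightarrow> ('b \<Rightarrow>\<^sub>0 complex) \<Rightarrow> ('b \<Rightarrow>\<^sub>0 complex)) \<Rightarrow>
      (complex \<Rightarrow> 'v::ab_group_add \<Rightarrow> 'v) \<Rightarrow> (('b \<Rightarrow>\<^sub>0 complex) \<Rightarrow> 'v \<Rightarrow> 'v) \<Rightarrow> bool" where
  "lie_module br scale \<rho> \<longleftrightarrow>
     vector_space scale \<and>
     (\<forall>x. Vector_Spaces.linear scale scale (\<rho> x)) \<and>
     (\<forall>v. Vector_Spaces.linear fscale scale (\<lambda>x. \<rho> x v)) \<and>
     (\<forall>x y v. \<rho> (br x y) v = \<rho> x (\<rho> y v) - \<rho> y (\<rho> x v))"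

definition invariant_subspace ::
    "(complex \<Rightarrow> 'v::ab_group_add \<Rightarrow> 'v) \<Rightarrow> 'l set \<Rightarrow> ('l \<Rightarrow> 'v \<Rightarrow> 'v) \<Rightarrow> 'v set \<Rightarrow> bool" where
  "invariant_subspace scale L \<rho> N \<longleftrightarrow>
     module.subspace scale N \<and> (\<forall>x\<in>L. \<forall>v\<in>N. \<rho> x v \<in> N)"

text \<open>Irreducibility of the representation of \<open>L\<close> on the whole type \<open>'v\<close>.\<close>

definition irreducible_rep ::
    "(complex \<Rightarrow> 'v::ab_group_add \<Rightarrow> 'v) \<Rightarrow> 'l set \<Rightarrow> ('l \<Rightarrow> 'v \<Rightarrow> 'v) \<Rightarrow> bool" where
  "irreducible_rep scale L \<rho> \<longleftrightarrow>
     (UNIV :: 'v set) \<noteq> {0} \<and>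
     (\<forall>N. invariant_subspace scale L \<rho> N \<longrightarrow> N = {0} \<or> N = UNIV)"

definition generated_by ::
    "(complex \<Rightarrow> 'v::ab_group_add \<Rightarrow> 'v) \<Rightarrow> 'l set \<Rightarrow> ('l \<Rightarrow> 'v \<Rightarrow> 'v) \<Rightarrow> 'v set \<Rightarrow> bool" where
  "generated_by scale L \<rho> S \<longleftrightarrow>
     \<Inter> {N. invariant_subspace scale L \<rho> N \<and> S \<subseteq> N} = UNIV"


section \<open>The Lie algebra \<open>gl\<^sup>~(\<infinity>)\<close>\<close>

text \<open>\<open>PlusHalf k\<close> is the half-integer \<open>k + 1/2\<close>.\<close>

datatype half_int = PlusHalf int

fun hval :: "half_int \<Rightarrow> rat" where
  "hval (PlusHalf k) = of_int k + 1/2"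

instantiation half_int :: uminus
begin

fun uminus_half_int :: "half_int \<Rightarrow> half_int" where
  "uminus_half_int (PlusHalf k) = PlusHalf (- k - 1)"

instance ..

end

lemma hval_uminus [simp]: "hval (- l) = - hval l"
  by (cases l) simp

datatype glt_basis = E half_int half_int | Kappa0

type_synonym glt = "glt_basis \<Rightarrow>\<^sub>0 complex"

definition HH :: "half_int \<Rightarrow> complex" where
  "HH l = (if hval l > 0 then 1 else 0)"

text \<open>The associative product of \<open>\<E>\<^bsub>l1,l2\<^esub>\<close> and \<open>\<E>\<^bsub>k1,k2\<^esub>\<close>.\<close>

definition E_prod :: "half_int \<Rightarrow> half_int \<Rightarrow> half_int \<Rightarrow> half_int \<Rightarrow> glt" where
  "E_prod l1 l2 k1 k2 = (if hval l2 + hval k1 = 0 then bvec (E l1 k2) else 0)"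

fun glt_bracket_basis :: "glt_basis \<Rightarrow> glt_basis \<Rightarrow> glt" where
  "glt_bracket_basis (E l1 l2) (E k1 k2) =
     E_prod l1 l2 k1 k2 - E_prod k1 k2 l1 l2 +
     (if hval l1 + hval k2 = 0 \<and> hval l2 + hval k1 = 0
      then fscale (HH l1 * HH l2 - HH k1 * HH k2) (bvec Kappa0) else 0)"
| "glt_bracket_basis Kappa0 _ = 0"
| "glt_bracket_basis _ Kappa0 = 0"

definition glt_bracket :: "glt \<Rightarrow> glt \<Rightarrow> glt" where
  "glt_bracket = bilin_ext fscale glt_bracket_basis"

definition glt_torus :: "glt set" where
  "glt_torus = module.span fscale (insert (bvec Kappa0) {bvec (E l (- l)) | l. True})"

text \<open>The dual space of the torus; functionals are \<open>undefined\<close> outside the torus.\<close>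

definition glt_weights :: "(glt \<Rightarrow> complex) set" where
  "glt_weights = {\<mu> \<in> extensional glt_torus.
     (\<forall>x\<in>glt_torus. \<forall>y\<in>glt_torus. \<mu> (x + y) = \<mu> x + \<mu> y) \<and>
     (\<forall>c. \<forall>x\<in>glt_torus. \<mu> (fscale c x) = c * \<mu> x)}"

definition weight_space ::
    "(complex \<Rightarrow> 'v::ab_group_add \<Rightarrow> 'v) \<Rightarrow> (glt \<Rightarrow> 'v \<Rightarrow> 'v) \<Rightarrow> (glt \<Rightarrow> complex) \<Rightarrow> 'v set" where
  "weight_space scale \<rho> \<mu> = {v. \<forall>h\<in>glt_torus. \<rho> h v = scale (\<mu> h) v}"

text \<open>The module is the internal direct sum of its weight spaces.\<close>

definition weighted ::
    "(complex \<Rightarrow> 'v::ab_group_add \<Rightarrow> 'v) \<Rightarrow> (glt \<Rightarrow> 'v \<Rightarrow> 'v) \<Rightarrow> bool" where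
  "weighted scale \<rho> \<longleftrightarrow>
     (\<forall>v. \<exists>!f. finite {\<mu>. f \<mu> \<noteq> 0} \<and>
        (\<forall>\<mu>. f \<mu> \<noteq> 0 \<longrightarrow> \<mu> \<in> glt_weights \<and> f \<mu> \<in> weight_space scale \<rho> \<mu>) \<and>
        v = (\<Sum>\<mu> | f \<mu> \<noteq> 0. f \<mu>))"

definition glt_above :: "nat \<Rightarrow> glt set" where
  "glt_above m = module.span fscale
     (\<Union>l1\<in>{l. hval l > of_nat m}. \<Union>l2\<in>{l. hval l > of_nat m}.
        {bvec (E l1 (- l2)), bvec (E (- l1) l2)})"


section \<open>Differential operators on the circle\<close>

definition ffact :: "complex \<Rightarrow> nat \<Rightarrow> complex" where
  "ffact \<mu> m = (\<Prod>k<m. \<mu> - of_nat k)"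

text \<open>The basis element \<open>(m, r)\<close> stands for \<open>t\<^sup>m \<partial>\<^sub>t\<^sup>r\<close>.\<close>

type_synonym diffop = "(int \<times> nat) \<Rightarrow>\<^sub>0 complex"

text \<open>
  Leibniz rule:
  \<open>\<partial>\<^sub>t\<^sup>r \<cdot> t\<^sup>m = \<Sum>s\<le>r. binom(r,s) \<langle>m\<rangle>\<^sub>s t\<^bsup>m-s\<^esup> \<partial>\<^sub>t\<^bsup>r-s\<^esup>\<close>.
\<close>

definition diffop_mult :: "diffop \<Rightarrow> diffop \<Rightarrow> diffop" where
  "diffop_mult = bilin_ext fscale (\<lambda>(m1, r1) (m2, r2).
     \<Sum>s\<le>r1. fscale (of_nat (r1 choose s) * ffact (of_int m2) s)
                (bvec (m1 + m2 - int s, r1 + r2 - s)))"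

text \<open>
  Agreement with composition of operators: \<open>t\<^sup>m \<partial>\<^sub>t\<^sup>r\<close> maps \<open>t\<^sup>x\<close> to
  \<open>\<langle>x\<rangle>\<^sub>r t\<^bsup>x+m-r\<^esup>\<close>, and the structure constants above satisfy the following.
\<close>

lemma ffact_Suc: "ffact x (Suc r) = ffact x r * (x - of_nat r)"
  by (simp add: ffact_def)

lemma ffact_add: "ffact x (r + s) = ffact x r * ffact (x - of_nat r) s"
  by (induction s) (simp_all add: ffact_Suc ffact_def[of _ 0] algebra_simps)

lemma ffact_gchoose: "ffact x r = fact r * (x gchoose r)"
  by (simp add: ffact_def gbinomial_prod_rev atLeast0LessThan)

lemma ffact_Vandermonde:
  "ffact (x + y) r = (\<Sum>s\<le>r. of_nat (r choose s) * ffact x s * ffact y (r - s))"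
proof -
  have "ffact (x + y) r = fact r * (\<Sum>s\<le>r. (x gchoose s) * (y gchoose (r - s)))"
    using gbinomial_Vandermonde[of x y r] by (simp add: ffact_gchoose atLeast0AtMost)
  also have "\<dots> = (\<Sum>s\<le>r. of_nat (r choose s) * ffact x s * ffact y (r - s))"
    unfolding sum_distrib_left ffact_gchoose
  proof (rule sum.cong, simp)
    fix s assume "s \<in> {..r}"
    hence "(of_nat (r choose s) :: complex) * fact s * fact (r - s) = fact r"
      by (simp add: binomial_fact)
    thus "fact r * ((x gchoose s) * (y gchoose (r - s))) =
        of_nat (r choose s) * (fact s * (x gchoose s)) * (fact (r - s) * (y gchoose (r - s)))"
      by (metis (no_types, opaque_lifting) mult.assoc mult.left_commute)
  qed
  finally show ?thesis .
qed

lemma diffop_mult_composition: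
  "ffact x r2 * ffact (x + m2 - of_nat r2) r1 =
     (\<Sum>s\<le>r1. of_nat (r1 choose s) * ffact m2 s * ffact x (r1 + r2 - s))"
proof -
  have "ffact (x + m2 - of_nat r2) r1 =
      (\<Sum>s\<le>r1. of_nat (r1 choose s) * ffact m2 s * ffact (x - of_nat r2) (r1 - s))"
    using ffact_Vandermonde[of m2 "x - of_nat r2" r1] by (simp add: algebra_simps)
  moreover have "ffact x (r1 + r2 - s) = ffact x r2 * ffact (x - of_nat r2) (r1 - s)"
    if "s \<le> r1" for s
    using ffact_add[of x r2 "r1 - s"] that by (simp add: add.commute)
  ultimately show ?thesis
    by (simp add: sum_distrib_left mult_ac)
qed


section \<open>The Lie algebras \<open>gl\<^sup>^(n, A)\<close> and \<open>sp\<^sup>^(\<ell>, A)\<close>\<close>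

text \<open>
  \<open>TD m r i j\<close> stands for \<open>t\<^sup>m \<partial>\<^sub>t\<^sup>r E\<^bsub>i,j\<^esub>\<close>. The type below allows arbitrary matrix indices;
  \<open>glh n\<close> is cut out by \<open>i, j \<in> {1..n}\<close>. The bracket is recorded although irreducibility
  refers only to the operators by which elements act.
\<close>

datatype glh_basis = TD int nat nat nat | Kappa

type_synonym glh_elem = "glh_basis \<Rightarrow>\<^sub>0 complex"

definition mat_unit :: "diffop \<Rightarrow> nat \<Rightarrow> nat \<Rightarrow> glh_elem" where
  "mat_unit a i j = lin_ext fscale (\<lambda>(m, r). bvec (TD m r i j)) a"

definition glh :: "nat \<Rightarrow> glh_elem set" where
  "glh n = module.span fscale
     (insert (bvec Kappa) {bvec (TD m r i j) | m r i j. i \<in> {1..n} \<and> j \<in> {1..n}})"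

fun glh_bracket_basis :: "glh_basis \<Rightarrow> glh_basis \<Rightarrow> glh_elem" where
  "glh_bracket_basis (TD m1 r1 i1 j1) (TD m2 r2 i2 j2) =
     (if j1 = i2 then mat_unit (diffop_mult (bvec (m1, r1)) (bvec (m2, r2))) i1 j2 else 0) -
     (if i1 = j2 then mat_unit (diffop_mult (bvec (m2, r2)) (bvec (m1, r1))) i2 j1 else 0) +
     (if i1 = j2 \<and> j1 = i2 \<and> int (r1 + r2) = m1 + m2
      then fscale ((-1) ^ r1 * fact r1 * fact r2 * (of_int m1 gchoose (r1 + r2 + 1))) (bvec Kappa)
      else 0)"
| "glh_bracket_basis Kappa _ = 0"
| "glh_bracket_basis _ Kappa = 0"

definition glh_bracket :: "glh_elem \<Rightarrow> glh_elem \<Rightarrow> glh_elem" where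
  "glh_bracket = bilin_ext fscale glh_bracket_basis"

definition parity :: "nat \<Rightarrow> nat \<Rightarrow> nat" where
  "parity n0 i = (if i \<le> n0 then 0 else 1)"

definition sp_generator ::
    "nat \<Rightarrow> nat \<Rightarrow> (nat \<Rightarrow> nat) \<Rightarrow> int \<Rightarrow> nat \<Rightarrow> nat \<Rightarrow> nat \<Rightarrow> glh_elem" where
  "sp_generator n0 \<epsilon> ell m r i j =
     (let n = 2 * n0 in
      mat_unit (bvec (m, r + ell j)) i j -
      fscale ((-1) ^ (parity n0 i + parity n0 j + \<epsilon>))
        (mat_unit (diffop_mult (fscale ((-1) ^ r) (bvec (0, r))) (bvec (m, ell i)))
           (n + 1 - j) (n + 1 - i)))"

definition sp_hat :: "nat \<Rightarrow> nat \<Rightarrow> (nat \<Rightarrow> nat) \<Rightarrow> glh_elem set" where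
  "sp_hat n0 \<epsilon> ell = module.span fscale
     (insert (bvec Kappa)
        {sp_generator n0 \<epsilon> ell m r i j | m r i j. i \<in> {1..2 * n0} \<and> j \<in> {1..2 * n0}})"


lemma sp_hat_subset_glh: "sp_hat n0 \<epsilon> ell \<subseteq> glh (2 * n0)"
proof -
  interpret vector_space "fscale :: complex \<Rightarrow> glh_elem \<Rightarrow> glh_elem"
    by (rule vector_space_fscale)
  have mat: "mat_unit a i j \<in> glh n" if "i \<in> {1..n}" "j \<in> {1..n}" for a i j n
    unfolding mat_unit_def lin_ext_def glh_def using that
    by (intro span_sum span_scale span_base) (auto split: prod.splits)
  show ?thesis
    unfolding sp_hat_def
  proof (rule span_minimal)
    show sub: "subspace (glh (2 * n0))"
      unfolding glh_def by (rule subspace_span)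
    have "sp_generator n0 \<epsilon> ell m r i j \<in> glh (2 * n0)"
      if "i \<in> {1..2 * n0}" "j \<in> {1..2 * n0}" for m r i j
      unfolding sp_generator_def Let_def
      by (intro subspace_diff[OF sub] subspace_scale[OF sub] mat) (use that in auto)
    moreover have "bvec Kappa \<in> glh (2 * n0)"
      unfolding glh_def by (rule span_base) simp
    ultimately show "insert (bvec Kappa)
        {sp_generator n0 \<epsilon> ell m r i j | m r i j. i \<in> {1..2 * n0} \<and> j \<in> {1..2 * n0}}
        \<subseteq> glh (2 * n0)"
      by blast
  qed
qed


section \<open>The representation\<close>

text \<open>
  The generating function of the coefficients, read as an identity of power series in
  \<open>w = z\<^sup>-\<^sup>1\<close> whose coefficients are polynomials in \<open>x\<close> and \<open>y\<close>, after multiplication by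
  \<open>x - y\<close>. Here \<open>monom (monom c b) a\<close> is \<open>c x\<^sup>a y\<^sup>b\<close>, and
  \<open>((z+y)/(z+x))\<^sup>\<iota> = (1 + y w)\<^sup>\<iota> (1 + x w)\<^sup>-\<^sup>\<iota>\<close>.
\<close>

definition is_Im_family :: "complex \<Rightarrow> (nat \<Rightarrow> nat \<Rightarrow> complex) \<Rightarrow> bool" where
  "is_Im_family \<iota> J \<longleftrightarrow>
     fps_const (monom 1 1 - monom (monom 1 1) 0) *
       Abs_fps (\<lambda>N. \<Sum>(r1, r2) | r1 + r2 + 1 = N. monom (monom (J r1 r2) r2) r1) =
     Abs_fps (\<lambda>k. monom (monom (\<iota> gchoose k) k) 0) *
       Abs_fps (\<lambda>k. monom (monom ((-\<iota>) gchoose k) 0) k) - 1"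

definition Im_coeff :: "complex \<Rightarrow> nat \<Rightarrow> nat \<Rightarrow> complex" where
  "Im_coeff \<iota> = (THE J. is_Im_family \<iota> J)"

lemma finite_degree_slice: "finite {(r1::nat, r2). r1 + r2 + 1 = N}"
  by (rule finite_subset[of _ "{..N} \<times> {..N}"]) auto

lemma coeff_degree_slice:
  "coeff (coeff (\<Sum>(r1, r2)\<in>{(r1, r2). r1 + r2 + 1 = N}. monom (monom (J r1 r2) r2) r1) a) b =
     (if a + b + 1 = N then (J a b :: complex) else 0)"
proof -
  have "coeff (coeff (\<Sum>(r1, r2)\<in>{(r1, r2). r1 + r2 + 1 = N}. monom (monom (J r1 r2) r2) r1) a) b
      = (\<Sum>p\<in>{(r1, r2). r1 + r2 + 1 = N}. if p = (a, b) then J a b else 0)"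
    unfolding coeff_sum by (rule sum.cong) (auto split: if_splits)
  also have "\<dots> = (if a + b + 1 = N then J a b else 0)"
    using finite_degree_slice[of N] by (simp add: sum.delta)
  finally show ?thesis .
qed

lemma is_Im_family_unique:
  assumes "is_Im_family \<iota> J" and "is_Im_family \<iota> J'"
  shows "J = J'"
proof (intro ext)
  fix a b
  let ?S = "\<lambda>J N. \<Sum>(r1, r2)\<in>{(r1, r2). r1 + r2 + 1 = N}. monom (monom (J r1 r2 :: complex) r2) r1"
  let ?d = "monom 1 1 - monom (monom 1 1) 0 :: complex poly poly"
  have "coeff ?d 1 \<noteq> 0" by simp
  hence "?d \<noteq> 0" by (metis coeff_0)
  have "fps_const ?d * Abs_fps (?S J) = fps_const ?d * Abs_fps (?S J')"
    using assms unfolding is_Im_family_def by simp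
  from arg_cong[OF this, of "\<lambda>f. fps_nth f (a + b + 1)"]
  have "?d * ?S J (a + b + 1) = ?d * ?S J' (a + b + 1)"
    by (simp only: fps_mult_left_const_nth fps_nth_Abs_fps)
  with \<open>?d \<noteq> 0\<close> have "?S J (a + b + 1) = ?S J' (a + b + 1)"
    by (blast dest: mult_left_cancel[THEN iffD1, rotated])
  hence "coeff (coeff (?S J (a + b + 1)) a) b = coeff (coeff (?S J' (a + b + 1)) a) b"
    by simp
  thus "J a b = J' a b"
    by (simp only: coeff_degree_slice) simp
qed

lemma is_Im_family_explicit:
  "is_Im_family \<iota> (\<lambda>a b. - (\<Sum>k\<le>a. ((-\<iota>) gchoose k) * (\<iota> gchoose (a + b + 1 - k))))"
  (is "is_Im_family \<iota> ?J")
proof -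
  let ?S = "\<lambda>N. \<Sum>(r1, r2)\<in>{(r1, r2). r1 + r2 + 1 = N}. monom (monom (?J r1 r2) r2) r1"
  let ?c = "\<lambda>a b. ((-\<iota>) gchoose a) * (\<iota> gchoose b)"
  have vand: "(\<Sum>k\<le>N. ?c k (N - k)) = (if N = 0 then 1 else 0)" for N
    using gbinomial_Vandermonde[of "-\<iota>" "\<iota>" N] by (cases N) (simp_all add: atLeast0AtMost)
  have "(monom 1 1 - monom (monom 1 1) 0) * ?S N =
      (\<Sum>i=0..N. monom (monom (\<iota> gchoose i) i) 0 * monom (monom ((-\<iota>) gchoose (N - i)) 0) (N - i))
      - (if N = 0 then 1 else 0)" (is "?L = ?R") for N
  proof (intro poly_eqI)
    fix a b
    have rhs: "coeff (coeff ?R a) b =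
        (if a + b = N then ?c a b else 0) - (if N = 0 \<and> a = 0 \<and> b = 0 then 1 else 0)"
    proof -
      have "coeff (coeff (\<Sum>i=0..N. monom (monom (\<iota> gchoose i) i) 0 *
                monom (monom ((-\<iota>) gchoose (N - i)) 0) (N - i)) a) b
          = (\<Sum>i=0..N. if i = b then (if a + b = N then ?c a b else 0) else 0)"
        unfolding coeff_sum by (rule sum.cong) (auto simp: mult_monom)
      also have "\<dots> = (if a + b = N then ?c a b else 0)"
        by (auto simp: sum.delta)
      finally show ?thesis by auto
    qed
    have "coeff (coeff ?L a) b =
        (if a = 0 then 0 else coeff (coeff (?S N) (a - 1)) b) -
        (if b = 0 then 0 else coeff (coeff (?S N) a) (b - 1))"
      by (simp add: left_diff_distrib coeff_monom_mult monom_0 del: One_nat_def)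
    also have "\<dots> = coeff (coeff ?R a) b"
    proof (cases "a + b = N")
      case False
      then show ?thesis unfolding rhs coeff_degree_slice by auto
    next
      case True
      show ?thesis
      proof (cases a)
        case 0
        then show ?thesis unfolding rhs coeff_degree_slice using True by (cases b) auto
      next
        case (Suc a')
        then show ?thesis unfolding rhs coeff_degree_slice
          using True vand[of N] by (cases b) (auto simp: algebra_simps neg_eq_iff_add_eq_0 add.commute)
      qed
    qed
    finally show "coeff (coeff ?L a) b = coeff (coeff ?R a) b" .
  qed
  thus ?thesis unfolding is_Im_family_def
    by (intro fps_ext, unfold fps_sub_nth fps_mult_left_const_nth,
        unfold fps_mult_nth fps_nth_Abs_fps fps_one_nth)
qed

lemma is_Im_family_Im_coeff: "is_Im_family \<iota> (Im_coeff \<iota>)"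
  unfolding Im_coeff_def
  by (rule theI[of "is_Im_family \<iota>"], rule is_Im_family_explicit, erule is_Im_family_unique, rule is_Im_family_explicit)

lemma Im_coeff_0: "Im_coeff \<iota> 0 r = - (\<iota> gchoose (r + 1))"
  unfolding is_Im_family_unique[OF is_Im_family_Im_coeff is_Im_family_explicit] by simp

text \<open>
  The sum over \<open>l\<close> is \<open>Sum_any\<close>, i.e. the sum of the nonzero terms, provided that there are
  finitely many of them. This is the case for all \<open>v\<close> in a module as in the theorem.
\<close>

fun sigma_basis ::
    "nat \<Rightarrow> complex \<Rightarrow> (complex \<Rightarrow> 'v::ab_group_add \<Rightarrow> 'v) \<Rightarrow> (glt \<Rightarrow> 'v \<Rightarrow> 'v) \<Rightarrow>
      glh_basis \<Rightarrow> 'v \<Rightarrow> 'v" where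
  "sigma_basis n \<iota> scale \<rho> (TD m r i j) v =
     Sum_any (\<lambda>l::int. scale (ffact (\<iota> - of_int l) r)
       (\<rho> (bvec (E (PlusHalf ((m - int r - l) * int n + int i - 1))
                   (PlusHalf (l * int n - int j)))) v)) +
     (if i = j \<and> int r = m then scale (fact r * Im_coeff \<iota> 0 r) (\<rho> (bvec Kappa0) v) else 0)"
| "sigma_basis n \<iota> scale \<rho> Kappa v = \<rho> (bvec Kappa0) v"

definition sigma_rep ::
    "nat \<Rightarrow> complex \<Rightarrow> (complex \<Rightarrow> 'v::ab_group_add \<Rightarrow> 'v) \<Rightarrow> (glt \<Rightarrow> 'v \<Rightarrow> 'v) \<Rightarrow>
      glh_elem \<Rightarrow> 'v \<Rightarrow> 'v" where
  "sigma_rep n \<iota> scale \<rho> x v = lin_ext scale (\<lambda>b. sigma_basis n \<iota> scale \<rho> b v) x"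

end

theory Submission
  imports Defs
begin

text \<open>
  The two Lie algebras have the same invariant subspaces, which settles irreducibility in both
  directions. A submodule for \<open>gl\<^sup>~(\<infinity>)\<close> is stable under \<open>\<sigma>\<close> because every operator of \<open>\<sigma>\<close> is,
  on a given vector, a finite combination of operators of \<open>gl\<^sup>~(\<infinity>)\<close>.

  For the converse, read \<open>v\<^bsub>kn+i-1/2\<^esub>\<close> as \<open>t\<^bsup>\<iota>+k\<^esup> e\<^sub>i\<close>; then \<open>\<sigma>\<close> is the action of matrix differential
  operators on the span of these vectors, carried over to \<open>M\<close> up to central terms. Fix indices
  \<open>i, j\<close> and a shift \<open>k\<close>, and let the order \<open>r\<close> of the generator of \<open>sp\<^sup>^(\<ell>, A)\<close> vary, with exponent
  \<open>m = k + r + \<ell>\<^sub>j\<close>. Its first half multiplies the \<open>l\<close>-th matrix unit by a constant independent of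
  \<open>r\<close> times \<open>\<langle>\<iota> - l - \<ell>\<^sub>j\<rangle>\<^sub>r\<close>. In its second half, the sign \<open>(-1)\<^sup>r\<close> of the adjoint \<open>(-\<partial>)\<^sup>r\<close> makes
  \<open>\<langle>-\<iota> + (integer)\<rangle>\<^sub>r\<close> the factor that depends on \<open>r\<close>. So the whole family in \<open>r\<close> evaluates the polynomials
  \<open>\<langle>x\<rangle>\<^sub>r\<close>, a basis of all polynomials, at the nodes \<open>\<iota> + integer\<close> and \<open>-\<iota> + integer\<close>
  (\<open>sigma_rep_generator\<close>). The two kinds of nodes never meet, as \<open>2\<iota>\<close> is not an integer.

  On a given vector only finitely many of these matrix units act nontrivially
  (\<open>annihilated_from_exists\<close>, \<open>shift_unit_finite\<close>), so interpolation at finitely many distinct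
  nodes extracts each of them separately (\<open>ffact_separation\<close>). The constant in front of the
  first half is the falling factorial of \<open>\<iota> - l\<close> of order \<open>\<ell>\<^sub>j\<close>, nonzero since \<open>\<iota>\<close> is not an integer, and every
  \<open>\<E>\<^bsub>a,c\<^esub>\<close> occurs for some \<open>i, j, k, l\<close>. Central terms do no harm: \<open>\<kappa>\<close> itself lies in
  \<open>sp\<^sup>^(\<ell>, A)\<close> and acts as \<open>\<kappa>\<^sub>0\<close>.
\<close>

section \<open>Linear extension\<close>

lemma fscale_fscale [simp]: "fscale c (fscale d x) = fscale (c * d) x"
  by (rule poly_mapping_eqI) simp

lemma fscale_sum: "fscale c (\<Sum>i\<in>I. g i) = (\<Sum>i\<in>I. fscale c (g i))"
  by (rule poly_mapping_eqI) (simp add: lookup_sum sum_distrib_left)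

lemma bvec_expansion:
  "x = (\<Sum>b\<in>Poly_Mapping.keys x. fscale (Poly_Mapping.lookup x b) (bvec b))"
proof (rule poly_mapping_eqI)
  fix b
  have "Poly_Mapping.lookup (\<Sum>a\<in>Poly_Mapping.keys x. fscale (Poly_Mapping.lookup x a) (bvec a)) b
      = (\<Sum>a\<in>Poly_Mapping.keys x. if a = b then Poly_Mapping.lookup x b else 0)"
    unfolding lookup_sum by (rule sum.cong) (auto simp: bvec_def lookup_single)
  also have "\<dots> = Poly_Mapping.lookup x b"
    by (simp add: in_keys_iff)
  finally show "Poly_Mapping.lookup x b = Poly_Mapping.lookup
      (\<Sum>a\<in>Poly_Mapping.keys x. fscale (Poly_Mapping.lookup x a) (bvec a)) b" by simp
qed

context
  fixes scale :: "complex \<Rightarrow> 'v::ab_group_add \<Rightarrow> 'v"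
  assumes vs: "vector_space scale"
begin

interpretation vector_space scale by (rule vs)

lemma lin_ext_superset:
  assumes "finite F" and "Poly_Mapping.keys x \<subseteq> F"
  shows "lin_ext scale f x = (\<Sum>b\<in>F. scale (Poly_Mapping.lookup x b) (f b))"
  unfolding lin_ext_def
  by (rule sum.mono_neutral_left) (use assms in \<open>auto simp: in_keys_iff\<close>)

lemma lin_ext_add: "lin_ext scale f (x + y) = lin_ext scale f x + lin_ext scale f y"
proof -
  let ?F = "Poly_Mapping.keys x \<union> Poly_Mapping.keys y"
  have "Poly_Mapping.keys (x + y) \<subseteq> ?F" by (rule keys_add)
  then show ?thesis
    by (simp add: lin_ext_superset[of ?F] lookup_add scale_left_distrib sum.distrib)
qed

lemma lin_ext_fscale: "lin_ext scale f (fscale c x) = scale c (lin_ext scale f x)"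
proof -
  have "Poly_Mapping.keys (fscale c x) \<subseteq> Poly_Mapping.keys x"
    by (auto simp: in_keys_iff)
  then show ?thesis
    by (simp add: lin_ext_superset[of "Poly_Mapping.keys x"] scale_sum_right)
qed

lemma lin_ext_bvec: "lin_ext scale f (bvec b) = f b"
  by (simp add: lin_ext_def bvec_def)

lemma lin_ext_zero: "lin_ext scale f 0 = 0"
  by (simp add: lin_ext_def)

lemma lin_ext_sum: "lin_ext scale f (\<Sum>i\<in>I. g i) = (\<Sum>i\<in>I. lin_ext scale f (g i))"
  by (induction I rule: infinite_finite_induct) (simp_all add: lin_ext_zero lin_ext_add)

lemma lin_ext_diff: "lin_ext scale f (x - y) = lin_ext scale f x - lin_ext scale f y"
  using lin_ext_add[of f "x - y" y] by simp

lemma lin_ext_lin_ext: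
  "lin_ext scale f (lin_ext fscale g x) = lin_ext scale (\<lambda>b. lin_ext scale f (g b)) x"
  unfolding lin_ext_def[of fscale] by (simp add: lin_ext_sum lin_ext_fscale lin_ext_def[of scale _ x])

end

section \<open>Falling factorials\<close>

lemma ffact_nonzero:
  assumes "\<forall>k::int. \<iota> \<noteq> of_int k / 2"
  shows "ffact (\<iota> - of_int l) r \<noteq> 0"
proof
  assume "ffact (\<iota> - of_int l) r = 0"
  then obtain k where "\<iota> - of_int l - of_nat k = 0"
    unfolding ffact_def by auto
  then have "\<iota> = of_int (2 * (l + int k)) / 2"
    by (simp add: algebra_simps)
  with assms show False by blast
qed

text \<open>
  This absorbs the sign in the formal adjoint \<open>(-\<partial>)\<^sup>r\<close> and moves the node from \<open>\<iota> + integer\<close> to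
  \<open>-\<iota> + integer\<close>.
\<close>

lemma ffact_reflect: "(-1) ^ r * ffact (x + of_nat r) r = ffact (- x - 1) r"
proof -
  have "ffact (x + of_nat r) r = (\<Prod>k<r. x + of_nat r - of_nat (r - Suc k))"
    unfolding ffact_def by (rule prod.nat_diff_reindex[symmetric])
  also have "\<dots> = (\<Prod>k<r. - (- x - 1 - of_nat k))"
    by (rule prod.cong) (auto simp: of_nat_diff)
  also have "\<dots> = (-1) ^ r * ffact (- x - 1) r"
    unfolding ffact_def by (simp only: prod_uminus card_lessThan)
  finally show ?thesis by (simp flip: mult.assoc power_mult_distrib)
qed

text \<open>
  The falling factorials span all polynomials, so this is Lagrange interpolation at the nodes
  \<open>y a\<close>, with values that need only be known modulo \<open>N\<close>. Interpolation is avoided by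
  removing one node at a time: since \<open>\<langle>y\<rangle>\<^bsub>r+1\<^esub> - (y\<^sub>b - r) \<langle>y\<rangle>\<^sub>r = \<langle>y\<rangle>\<^sub>r (y - y\<^sub>b)\<close>, a combination of
  two of the given sums is a sum of the same shape in which the term at \<open>b\<close> vanishes and the other
  vectors are rescaled by the nonzero numbers \<open>y a - y b\<close>.
\<close>

lemma ffact_separation:
  fixes scale :: "complex \<Rightarrow> 'v::ab_group_add \<Rightarrow> 'v"
  assumes vs: "vector_space scale" and N: "module.subspace scale N"
    and "finite F" and "inj_on y F"
    and "\<And>r. (\<Sum>a\<in>F. scale (ffact (y a) r) (w a)) \<in> N"
    and "a \<in> F"
  shows "w a \<in> N"
proof -
  interpret vector_space scale by (rule vs)
  show ?thesis
    using assms(3-6)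
  proof (induction F arbitrary: w a rule: finite_induct)
    case empty
    then show ?case by simp
  next
    case (insert b F)
    have rest: "w c \<in> N" if "c \<in> F" for c
    proof -
      have "(\<Sum>d\<in>F. scale (ffact (y d) r) (scale (y d - y b) (w d))) \<in> N" for r
      proof -
        have "(\<Sum>d\<in>insert b F. scale (ffact (y d) (Suc r)) (w d))
            - scale (y b - of_nat r) (\<Sum>d\<in>insert b F. scale (ffact (y d) r) (w d)) \<in> N"
          by (intro subspace_diff[OF N] subspace_scale[OF N] insert.prems(2))
        also have "(\<Sum>d\<in>insert b F. scale (ffact (y d) (Suc r)) (w d))
            - scale (y b - of_nat r) (\<Sum>d\<in>insert b F. scale (ffact (y d) r) (w d))
            = (\<Sum>d\<in>insert b F. scale (ffact (y d) r) (scale (y d - y b) (w d)))"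
          unfolding scale_sum_right sum_subtractf[symmetric]
          by (rule sum.cong) (simp_all add: ffact_Suc algebra_simps)
        finally show ?thesis using insert.hyps by simp
      qed
      then have "scale (y c - y b) (w c) \<in> N"
        using insert.IH[of "\<lambda>d. scale (y d - y b) (w d)" c] insert.prems(1) that by simp
      moreover have "y c - y b \<noteq> 0"
        using insert.prems(1) insert.hyps(2) that by (auto simp: inj_on_def)
      ultimately show ?thesis
        using subspace_scale[OF N, of "scale (y c - y b) (w c)" "inverse (y c - y b)"] by simp
    qed
    have "w b + (\<Sum>d\<in>F. w d) \<in> N"
      using insert.prems(2)[of 0] insert.hyps by (simp add: ffact_def)
    moreover have "(\<Sum>d\<in>F. w d) \<in> N"
      by (intro subspace_sum[OF N] rest)
    ultimately have "w b \<in> N"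
      using subspace_diff[OF N] by (metis add_diff_cancel_right')
    then show ?case using rest insert.prems(3) by auto
  qed
qed

section \<open>Modules over the central extension of infinite matrices\<close>

lemma glt_above_basis:
  assumes "hval l1 > of_nat m" and "hval l2 > of_nat m"
  shows "bvec (E l1 (- l2)) \<in> glt_above m" and "bvec (E (- l1) l2) \<in> glt_above m"
proof -
  interpret vector_space "fscale :: complex \<Rightarrow> glt \<Rightarrow> glt" by (rule vector_space_fscale)
  show "bvec (E l1 (- l2)) \<in> glt_above m" "bvec (E (- l1) l2) \<in> glt_above m"
    unfolding glt_above_def using assms
    by (intro span_base UN_I[of l1] UN_I[of l2]; simp)+
qed

locale glt_module =
  fixes scale :: "complex \<Rightarrow> 'v::ab_group_add \<Rightarrow> 'v" and \<rho> :: "glt \<Rightarrow> 'v \<Rightarrow> 'v"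
  assumes module: "lie_module glt_bracket scale \<rho>"
begin

sublocale vector_space scale
  using module unfolding lie_module_def by blast

lemma rho_hom: "module_hom scale scale (\<rho> x)"
  and rho_hom_left: "module_hom fscale scale (\<lambda>x. \<rho> x v)"
  using module unfolding lie_module_def linear_iff_module_hom by blast+

lemmas rho_add = module_hom.add[OF rho_hom]
  and rho_scale = module_hom.scale[OF rho_hom]
  and rho_zero = module_hom.zero[OF rho_hom]

lemma rho_expand: "\<rho> x v = lin_ext scale (\<lambda>b. \<rho> (bvec b) v) x"
proof -
  have "\<rho> x v = \<rho> (\<Sum>b\<in>Poly_Mapping.keys x. fscale (Poly_Mapping.lookup x b) (bvec b)) v"
    using bvec_expansion[of x] by simp
  also have "\<dots> = lin_ext scale (\<lambda>b. \<rho> (bvec b) v) x"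
    unfolding lin_ext_def
    by (simp only: module_hom.sum[OF rho_hom_left] module_hom.scale[OF rho_hom_left])
  finally show ?thesis .
qed

lemma invariant_subspace_basis:
  "invariant_subspace scale UNIV \<rho> N \<longleftrightarrow>
     subspace N \<and> (\<forall>b. \<forall>v\<in>N. \<rho> (bvec b) v \<in> N)"
proof
  assume "subspace N \<and> (\<forall>b. \<forall>v\<in>N. \<rho> (bvec b) v \<in> N)"
  then show "invariant_subspace scale UNIV \<rho> N"
    unfolding invariant_subspace_def
    by (subst rho_expand) (auto simp: lin_ext_def intro!: subspace_sum subspace_scale)
qed (simp add: invariant_subspace_def)

lemma basis_commute:
  assumes "glt_bracket_basis a b = 0"
  shows "\<rho> (bvec a) (\<rho> (bvec b) v) = \<rho> (bvec b) (\<rho> (bvec a) v)"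
proof -
  have "glt_bracket (bvec a) (bvec b) = 0"
    unfolding glt_bracket_def bilin_ext_def
    by (simp add: lin_ext_bvec[OF vector_space_fscale] assms)
  moreover have "\<rho> 0 v = 0" by (subst rho_expand) (simp add: lin_ext_def)
  moreover have "\<rho> (glt_bracket (bvec a) (bvec b)) v =
      \<rho> (bvec a) (\<rho> (bvec b) v) - \<rho> (bvec b) (\<rho> (bvec a) v)"
    using module unfolding lie_module_def by blast
  ultimately show ?thesis by simp
qed

text \<open>
  The product pairs a second index with the negative of a first one, so the main diagonal is
  \<open>p + q = -1\<close>, and opposite signs of \<open>p\<close> and \<open>q\<close> place the row and the column on the same side
  of the origin. The matrix units occurring in one operator \<open>\<sigma>(t\<^sup>m\<partial>\<^sup>rE\<^bsub>i,j\<^esub>)\<close> run to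
  infinity inside this region.
\<close>

definition annihilated_from :: "int \<Rightarrow> 'v \<Rightarrow> bool" where
  "annihilated_from K v \<longleftrightarrow>
     (\<forall>p q. (p > K \<and> q < - K) \<or> (p < - K \<and> q > K) \<longrightarrow>
        \<rho> (bvec (E (PlusHalf p) (PlusHalf q))) v = 0)"

lemma annihilated_from_mono: "annihilated_from K v \<Longrightarrow> K \<le> K' \<Longrightarrow> annihilated_from K' v"
  unfolding annihilated_from_def by (meson le_less_trans less_le_trans neg_le_iff_le)

text \<open>
  A matrix unit whose indices both exceed those of \<open>b\<close> in absolute value has zero bracket
  with \<open>b\<close>, so it can be moved past \<open>b\<close>.
\<close>

lemma annihilated_from_act:
  assumes "annihilated_from K v"
  shows "\<exists>K. annihilated_from K (\<rho> (bvec b) v)"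
proof (cases b)
  case Kappa0
  have "annihilated_from K (\<rho> (bvec b) v)"
    unfolding annihilated_from_def Kappa0
    by (subst basis_commute) (use assms in \<open>auto simp: annihilated_from_def rho_zero\<close>)
  then show ?thesis ..
next
  case (E l1 l2)
  obtain a c where ac: "l1 = PlusHalf a" "l2 = PlusHalf c"
    by (metis half_int.exhaust)
  define K' where "K' = max \<bar>K\<bar> (max (\<bar>a\<bar> + 1) (\<bar>c\<bar> + 1))"
  have "annihilated_from K' (\<rho> (bvec b) v)"
    unfolding annihilated_from_def
  proof (intro allI impI)
    fix p q assume pq: "(p > K' \<and> q < - K') \<or> (p < - K' \<and> q > K')"
    have ne: "q + a + 1 \<noteq> 0" "c + p + 1 \<noteq> 0"
      using pq unfolding K'_def by auto
    have hv: "hval (PlusHalf x) + hval (PlusHalf y) = 0 \<longleftrightarrow> x + y + 1 = 0" for x y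
    proof -
      have "hval (PlusHalf x) + hval (PlusHalf y) = of_int (x + y + 1)" by simp
      then show ?thesis by (simp only: of_int_eq_0_iff)
    qed
    have "glt_bracket_basis (E (PlusHalf p) (PlusHalf q)) b = 0"
      unfolding E ac glt_bracket_basis.simps E_prod_def hv using ne by simp
    then have "\<rho> (bvec (E (PlusHalf p) (PlusHalf q))) (\<rho> (bvec b) v)
        = \<rho> (bvec b) (\<rho> (bvec (E (PlusHalf p) (PlusHalf q))) v)"
      by (rule basis_commute)
    also have "\<rho> (bvec (E (PlusHalf p) (PlusHalf q))) v = 0"
    proof -
      have "annihilated_from K' v"
        by (rule annihilated_from_mono[OF assms]) (simp add: K'_def)
      with pq show ?thesis unfolding annihilated_from_def by blast
    qed
    finally show "\<rho> (bvec (E (PlusHalf p) (PlusHalf q))) (\<rho> (bvec b) v) = 0"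
      by (simp add: rho_zero)
  qed
  then show ?thesis ..
qed

text \<open>
  The vectors with this property form a submodule by \<open>annihilated_from_act\<close>, and it contains the
  generating space.
\<close>

lemma annihilated_from_exists:
  assumes gen: "generated_by scale UNIV \<rho> M0"
    and M0: "\<forall>x\<in>glt_above m. \<forall>v\<in>M0. \<rho> x v = 0"
  shows "\<exists>K. annihilated_from K v"
proof -
  let ?S = "{v. \<exists>K. annihilated_from K v}"
  have "subspace ?S"
    unfolding subspace_def
  proof (intro conjI allI ballI)
    show "0 \<in> ?S" by (simp add: annihilated_from_def rho_zero)
    show "u + v \<in> ?S" if "u \<in> ?S" "v \<in> ?S" for u v
    proof -
      from that obtain K K' where "annihilated_from K u" "annihilated_from K' v" by auto
      then have "annihilated_from (max K K') u" "annihilated_from (max K K') v"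
        using annihilated_from_mono by fastforce+
      then have "annihilated_from (max K K') (u + v)"
        by (simp add: annihilated_from_def rho_add)
      then show ?thesis by blast
    qed
    show "scale c v \<in> ?S" if "v \<in> ?S" for c v
      using that by (fastforce simp: annihilated_from_def rho_scale)
  qed
  moreover have "\<rho> (bvec b) v \<in> ?S" if "v \<in> ?S" for b v
    using annihilated_from_act that by blast
  ultimately have "invariant_subspace scale UNIV \<rho> ?S"
    by (simp add: invariant_subspace_basis)
  moreover have "M0 \<subseteq> ?S"
  proof
    fix v assume v: "v \<in> M0"
    have above: "hval (PlusHalf x) > of_nat m" if "x > int m" for x
    proof -
      have "of_int x > (of_int (int m) :: rat)" using that by (simp only: of_int_less_iff)
      then show ?thesis by simp
    qed
    have "annihilated_from (int m + 1) v"
      unfolding annihilated_from_def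
    proof (intro allI impI)
      fix p q assume pq: "(p > int m + 1 \<and> q < - (int m + 1)) \<or> (p < - (int m + 1) \<and> q > int m + 1)"
      have "bvec (E (PlusHalf p) (PlusHalf q)) \<in> glt_above m"
      proof (cases "p > 0")
        case True
        then have "hval (PlusHalf p) > of_nat m" "hval (PlusHalf (- q - 1)) > of_nat m"
          using pq by (auto intro!: above)
        from glt_above_basis(1)[OF this] show ?thesis by simp
      next
        case False
        then have "hval (PlusHalf (- p - 1)) > of_nat m" "hval (PlusHalf q) > of_nat m"
          using pq by (auto intro!: above)
        from glt_above_basis(2)[OF this] show ?thesis by simp
      qed
      then show "\<rho> (bvec (E (PlusHalf p) (PlusHalf q))) v = 0" using M0 v by blast
    qed
    then show "v \<in> ?S" by blast
  qed
  ultimately have "?S = UNIV"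
    using gen unfolding generated_by_def by blast
  then show ?thesis by blast
qed

text \<open>
  The matrix unit sending \<open>t\<^bsup>\<iota>-l\<^esup> e\<^sub>j\<close> to \<open>t\<^bsup>\<iota>-l+k\<^esup> e\<^sub>i\<close>; a differential operator of degree \<open>k\<close>
  times \<open>E\<^bsub>i,j\<^esub>\<close> is a combination of these over \<open>l\<close>.
\<close>

definition shift_unit :: "nat \<Rightarrow> int \<Rightarrow> nat \<Rightarrow> nat \<Rightarrow> int \<Rightarrow> glt" where
  "shift_unit n k i j l = bvec (E (PlusHalf ((k - l) * int n + int i - 1)) (PlusHalf (l * int n - int j)))"

lemma shift_unit_finite:
  assumes v: "annihilated_from K v" and n: "n > 0"
  shows "finite {l. \<rho> (shift_unit n k i j l) v \<noteq> 0}"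
proof (rule finite_subset)
  define B where "B = \<bar>k\<bar> + \<bar>K\<bar> + int i + int j + 1"
  show "finite {-B..B}" by simp
  show "{l. \<rho> (shift_unit n k i j l) v \<noteq> 0} \<subseteq> {-B..B}"
  proof (rule subsetI, rule ccontr)
    fix l assume l: "l \<in> {l. \<rho> (shift_unit n k i j l) v \<noteq> 0}" "l \<notin> {-B..B}"
    have n1: "1 \<le> int n" using n by simp
    define P where "P = (k - l) * int n"
    define Q where "Q = l * int n"
    \<comment> \<open>As \<open>\<bar>l\<bar>\<close> grows, the indices move in opposite directions, each by at least \<open>1\<close> per step.\<close>
    have "(P + int i - 1 > K \<and> Q - int j < - K) \<or> (P + int i - 1 < - K \<and> Q - int j > K)"
    proof (cases "l > B")
      case True
      have "0 \<le> l" "k - l \<le> 0" using True unfolding B_def by linarith+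
      then have "l * 1 \<le> Q" "P \<le> (k - l) * 1"
        unfolding P_def Q_def using mult_left_mono[OF n1] mult_left_mono_neg[OF n1] by blast+
      with True have "P + int i - 1 < - K \<and> Q - int j > K" unfolding B_def by arith
      then show ?thesis by blast
    next
      case False
      then have lB: "l < - B" using l by auto
      have "l \<le> 0" "0 \<le> k - l" using lB unfolding B_def by linarith+
      then have "Q \<le> l * 1" "(k - l) * 1 \<le> P"
        unfolding P_def Q_def using mult_left_mono[OF n1] mult_left_mono_neg[OF n1] by blast+
      with lB have "P + int i - 1 > K \<and> Q - int j < - K" unfolding B_def by arith
      then show ?thesis by blast
    qed
    then have "\<rho> (shift_unit n k i j l) v = 0"
      using v unfolding annihilated_from_def shift_unit_def P_def Q_def by blast
    with l show False by simp
  qed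
qed

lemma every_matrix_unit_is_shift_unit:
  assumes "n > 0"
  obtains k i j l where "i \<in> {1..n}" "j \<in> {1..n}" "bvec (E a c) = shift_unit n k i j l"
proof -
  obtain p q where pq: "a = PlusHalf p" "c = PlusHalf q" by (metis half_int.exhaust)
  \<comment> \<open>Euclidean division by \<open>n\<close>; the column \<open>q\<close> belongs to the basis vector with index \<open>- q - 1\<close>.\<close>
  define i where "i = nat (p mod int n) + 1"
  define j where "j = nat ((- q - 1) mod int n) + 1"
  define l where "l = - ((- q - 1) div int n)"
  define k where "k = p div int n + l"
  have p: "p = (k - l) * int n + int i - 1"
    using assms by (simp add: i_def k_def)
  have "- q - 1 = - l * int n + int j - 1"
    using assms by (simp add: j_def l_def)
  then have q: "q = l * int n - int j" by simp
  have "i \<in> {1..n}" "j \<in> {1..n}"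
    using assms by (auto simp: i_def j_def nat_less_iff Suc_le_eq)
  then show thesis using that[of i j k l] by (simp add: shift_unit_def pq flip: p q)
qed

section \<open>The action of the symplectic subalgebra\<close>

lemma sigma_basis_eq:
  assumes "finite L" and "\<And>l. l \<notin> L \<Longrightarrow> \<rho> (shift_unit n (m - int r) i j l) v = 0"
  shows "sigma_basis n \<iota> scale \<rho> (TD m r i j) v =
     (\<Sum>l\<in>L. scale (ffact (\<iota> - of_int l) r) (\<rho> (shift_unit n (m - int r) i j l) v)) +
     scale (if i = j \<and> int r = m then fact r * Im_coeff \<iota> 0 r else 0) (\<rho> (bvec Kappa0) v)"
proof -
  have "Sum_any (\<lambda>l. scale (ffact (\<iota> - of_int l) r) (\<rho> (shift_unit n (m - int r) i j l) v))
      = (\<Sum>l\<in>L. scale (ffact (\<iota> - of_int l) r) (\<rho> (shift_unit n (m - int r) i j l) v))"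
    by (rule Sum_any.expand_superset) (use assms in auto)
  then show ?thesis by (simp add: shift_unit_def)
qed

lemma sigma_rep_mat_unit:
  "sigma_rep n \<iota> scale \<rho> (mat_unit a i j) v =
     lin_ext scale (\<lambda>(m, r). sigma_basis n \<iota> scale \<rho> (TD m r i j) v) a"
  unfolding sigma_rep_def mat_unit_def
  by (simp add: lin_ext_lin_ext[OF vector_space_axioms] case_prod_unfold
      lin_ext_bvec[OF vector_space_axioms])

text \<open>
  Up to a central term, a product of differential operators acts by the product of the
  coefficients: all terms of the Leibniz expansion have the same degree, so they act through the
  same matrix units, and their coefficients add up by \<open>diffop_mult_composition\<close>.
\<close>

lemma sigma_rep_product:
  assumes "finite L" and "\<And>l. l \<notin> L \<Longrightarrow> \<rho> (shift_unit n (m - int r - int q) i j l) v = 0"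
  shows "\<exists>c. sigma_rep n \<iota> scale \<rho>
       (mat_unit (diffop_mult (fscale b (bvec (0, r))) (bvec (m, q))) i j) v =
     (\<Sum>l\<in>L. scale (b * ffact (\<iota> - of_int l) q * ffact (\<iota> - of_int l + of_int m - of_nat q) r)
        (\<rho> (shift_unit n (m - int r - int q) i j l) v)) + scale c (\<rho> (bvec Kappa0) v)"
proof -
  define d where "d l = \<rho> (shift_unit n (m - int r - int q) i j l) v" for l
  define e where "e s = b * (of_nat (r choose s) * ffact (of_int m) s)" for s
  define g where "g s = (if i = j \<and> int (r + q - s) = m - int s
      then fact (r + q - s) * Im_coeff \<iota> 0 (r + q - s) else 0)" for s
  have basis: "sigma_basis n \<iota> scale \<rho> (TD (m - int s) (r + q - s) i j) v =
      (\<Sum>l\<in>L. scale (ffact (\<iota> - of_int l) (r + q - s)) (d l)) + scale (g s) (\<rho> (bvec Kappa0) v)"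
    if "s \<le> r" for s
  proof -
    have sh: "m - int s - int (r + q - s) = m - int r - int q"
      using that by simp
    show ?thesis
      using sigma_basis_eq[of L n "m - int s" "r + q - s" i j v \<iota>, unfolded sh] assms
      unfolding d_def g_def by blast
  qed
  have coeff: "(\<Sum>s\<le>r. e s * ffact (\<iota> - of_int l) (r + q - s)) =
      b * ffact (\<iota> - of_int l) q * ffact (\<iota> - of_int l + of_int m - of_nat q) r" for l
    unfolding e_def mult.assoc diffop_mult_composition sum_distrib_left by simp
  have "diffop_mult (fscale b (bvec (0, r))) (bvec (m, q)) =
      (\<Sum>s\<le>r. fscale (e s) (bvec (m - int s, r + q - s)))"
    unfolding diffop_mult_def bilin_ext_def e_def
    by (simp add: lin_ext_bvec[OF vector_space_fscale] lin_ext_fscale[OF vector_space_fscale]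
        fscale_sum)
  then have "sigma_rep n \<iota> scale \<rho>
       (mat_unit (diffop_mult (fscale b (bvec (0, r))) (bvec (m, q))) i j) v =
      (\<Sum>s\<le>r. scale (e s) (sigma_basis n \<iota> scale \<rho> (TD (m - int s) (r + q - s) i j) v))"
    by (simp add: sigma_rep_mat_unit lin_ext_sum[OF vector_space_axioms]
        lin_ext_fscale[OF vector_space_axioms] lin_ext_bvec[OF vector_space_axioms] del: sigma_basis.simps)
  also have "\<dots> = (\<Sum>s\<le>r. (\<Sum>l\<in>L. scale (e s * ffact (\<iota> - of_int l) (r + q - s)) (d l)) +
      scale (e s * g s) (\<rho> (bvec Kappa0) v))"
    by (rule sum.cong) (simp_all add: basis scale_right_distrib scale_sum_right del: sigma_basis.simps)
  also have "\<dots> = (\<Sum>l\<in>L. scale (\<Sum>s\<le>r. e s * ffact (\<iota> - of_int l) (r + q - s)) (d l)) +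
      scale (\<Sum>s\<le>r. e s * g s) (\<rho> (bvec Kappa0) v)"
    by (subst sum.distrib, subst sum.swap) (simp add: scale_sum_left)
  finally show ?thesis unfolding coeff d_def by blast
qed

text \<open>
  The exponent \<open>k + r + \<ell>\<^sub>j\<close> makes the degrees \<open>k\<close> and \<open>u\<close> of the two halves independent of \<open>r\<close>.
  Hence, as \<open>r\<close> varies, only the falling factorials and the central term change.
\<close>

lemma sigma_rep_generator:
  fixes k :: int and ell :: "nat \<Rightarrow> nat" and i j :: nat
  defines "u \<equiv> k + int (ell j) - int (ell i)"
  assumes "finite L" and "\<And>l. l \<notin> L \<Longrightarrow> \<rho> (shift_unit n k i j l) v = 0"
    and "finite L'" and "\<And>l. l \<notin> L' \<Longrightarrow> \<rho> (shift_unit n u (n + 1 - j) (n + 1 - i) l) v = 0"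
    and n: "n = 2 * n0"
  shows "\<exists>c. sigma_rep n \<iota> scale \<rho> (sp_generator n0 \<epsilon> ell (k + int r + int (ell j)) r i j) v =
     (\<Sum>l\<in>L. scale (ffact (\<iota> - of_int l - of_nat (ell j)) r)
        (scale (ffact (\<iota> - of_int l) (ell j)) (\<rho> (shift_unit n k i j l) v))) +
     (\<Sum>l\<in>L'. scale (ffact (- \<iota> + of_int l - of_int u - 1) r)
        (scale ((-1) ^ (parity n0 i + parity n0 j + \<epsilon> + 1) * ffact (\<iota> - of_int l) (ell i))
          (\<rho> (shift_unit n u (n + 1 - j) (n + 1 - i) l) v))) +
     scale c (\<rho> (bvec Kappa0) v)"
proof -
  let ?m = "k + int r + int (ell j)"
  define sg :: complex where "sg = (-1) ^ (parity n0 i + parity n0 j + \<epsilon>)"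
  define c1 where "c1 = (if i = j \<and> int (r + ell j) = ?m
      then fact (r + ell j) * Im_coeff \<iota> 0 (r + ell j) else 0)"
  have sh: "?m - int (r + ell j) = k" "?m - int r - int (ell i) = u"
    by (simp_all add: u_def)
  have coeff: "(-1) ^ r * ffact (\<iota> - of_int l) (ell i) *
      ffact (\<iota> - of_int l + of_int ?m - of_nat (ell i)) r =
      ffact (- \<iota> + of_int l - of_int u - 1) r * ffact (\<iota> - of_int l) (ell i)" for l
    using ffact_reflect[of r "\<iota> - of_int l + of_int u"]
    by (simp add: u_def algebra_simps)
  have "sigma_rep n \<iota> scale \<rho> (mat_unit (bvec (?m, r + ell j)) i j) v =
      (\<Sum>l\<in>L. scale (ffact (\<iota> - of_int l) (r + ell j)) (\<rho> (shift_unit n k i j l) v)) +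
      scale c1 (\<rho> (bvec Kappa0) v)"
    unfolding sigma_rep_mat_unit c1_def
    using sigma_basis_eq[of L n ?m "r + ell j" i j v \<iota>, unfolded sh] assms(2,3)
    by (simp add: lin_ext_bvec[OF vector_space_axioms] del: sigma_basis.simps)
  moreover obtain c2 where "sigma_rep n \<iota> scale \<rho>
      (mat_unit (diffop_mult (fscale ((-1) ^ r) (bvec (0, r))) (bvec (?m, ell i))) (n + 1 - j) (n + 1 - i)) v =
      (\<Sum>l\<in>L'. scale (ffact (- \<iota> + of_int l - of_int u - 1) r * ffact (\<iota> - of_int l) (ell i))
        (\<rho> (shift_unit n u (n + 1 - j) (n + 1 - i) l) v)) + scale c2 (\<rho> (bvec Kappa0) v)"
    using sigma_rep_product[of L' n ?m r "ell i" "n + 1 - j" "n + 1 - i" v \<iota> "(-1) ^ r",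
        unfolded sh coeff] assms(4,5) by blast
  moreover have "sigma_rep n \<iota> scale \<rho> (sp_generator n0 \<epsilon> ell ?m r i j) v =
      sigma_rep n \<iota> scale \<rho> (mat_unit (bvec (?m, r + ell j)) i j) v -
      scale sg (sigma_rep n \<iota> scale \<rho>
      (mat_unit (diffop_mult (fscale ((-1) ^ r) (bvec (0, r))) (bvec (?m, ell i))) (n + 1 - j) (n + 1 - i)) v)"
    unfolding sp_generator_def Let_def sigma_rep_def sg_def n
    by (simp add: lin_ext_diff[OF vector_space_axioms] lin_ext_fscale[OF vector_space_axioms])
  moreover have "(\<Sum>l\<in>L. scale (ffact (\<iota> - of_int l) (r + ell j)) (\<rho> (shift_unit n k i j l) v)) =
      (\<Sum>l\<in>L. scale (ffact (\<iota> - of_int l - of_nat (ell j)) r)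
        (scale (ffact (\<iota> - of_int l) (ell j)) (\<rho> (shift_unit n k i j l) v)))"
    by (subst add.commute, subst ffact_add) (simp add: mult.commute)
  moreover have "(\<Sum>l\<in>L'. scale (ffact (- \<iota> + of_int l - of_int u - 1) r)
        (scale ((-1) ^ (parity n0 i + parity n0 j + \<epsilon> + 1) * ffact (\<iota> - of_int l) (ell i))
          (\<rho> (shift_unit n u (n + 1 - j) (n + 1 - i) l) v))) =
      - scale sg (\<Sum>l\<in>L'. scale (ffact (- \<iota> + of_int l - of_int u - 1) r * ffact (\<iota> - of_int l) (ell i))
        (\<rho> (shift_unit n u (n + 1 - j) (n + 1 - i) l) v))"
    unfolding scale_sum_right sum_negf[symmetric] sg_def by (rule sum.cong) (simp_all add: mult_ac)
  ultimately show ?thesis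
    by (intro exI[of _ "c1 - sg * c2"])
       (simp add: scale_right_distrib scale_left_diff_distrib del: of_int_add of_int_diff)
qed

text \<open>
  The generators of all orders \<open>r\<close> give the sums required by \<open>ffact_separation\<close>. Its index set is
  the disjoint union of the two families of matrix units, and its nodes are distinct because
  \<open>2\<iota>\<close> is not an integer.
\<close>

lemma matrix_unit_preserves:
  assumes n: "n = 2 * n0" and i: "i \<in> {1..n}" and j: "j \<in> {1..n}"
    and \<iota>: "\<forall>k::int. \<iota> \<noteq> of_int k / 2"
    and fin: "\<And>k i j. finite {l. \<rho> (shift_unit n k i j l) v \<noteq> 0}"
    and N: "invariant_subspace scale (sp_hat n0 \<epsilon> ell) (sigma_rep n \<iota> scale \<rho>) N" and v: "v \<in> N"
    and kappa: "\<rho> (bvec Kappa0) v \<in> N"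
  shows "\<rho> (shift_unit n k i j l0) v \<in> N"
proof (cases "\<rho> (shift_unit n k i j l0) v = 0")
  case True
  then show ?thesis
    using N unfolding invariant_subspace_def by (simp add: subspace_0)
next
  case False
  interpret P: vector_space "fscale :: complex \<Rightarrow> glh_elem \<Rightarrow> glh_elem" by (rule vector_space_fscale)
  have sub: "subspace N" using N unfolding invariant_subspace_def by simp
  define u where "u = k + int (ell j) - int (ell i)"
  define L where "L = {l. \<rho> (shift_unit n k i j l) v \<noteq> 0}"
  define L' where "L' = {l. \<rho> (shift_unit n u (n + 1 - j) (n + 1 - i) l) v \<noteq> 0}"
  define y where "y = case_sum (\<lambda>l. \<iota> - of_int l - of_nat (ell j))
      (\<lambda>l. - \<iota> + of_int l - of_int u - 1)"
  define w where "w = case_sum (\<lambda>l. scale (ffact (\<iota> - of_int l) (ell j)) (\<rho> (shift_unit n k i j l) v))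
      (\<lambda>l. scale ((-1) ^ (parity n0 i + parity n0 j + \<epsilon> + 1) * ffact (\<iota> - of_int l) (ell i))
          (\<rho> (shift_unit n u (n + 1 - j) (n + 1 - i) l) v))"
  have finL: "finite L" "finite L'" unfolding L_def L'_def by (rule fin)+
  have disj: "\<iota> - of_int l - of_nat (ell j) \<noteq> - \<iota> + of_int l' - of_int u - 1" for l l'
  proof
    assume "\<iota> - of_int l - of_nat (ell j) = - \<iota> + of_int l' - of_int u - 1"
    then have "\<iota> = of_int (l + int (ell j) + l' - u - 1) / 2"
      by (simp add: algebra_simps)
    with \<iota> show False by blast
  qed
  have inj: "inj_on y (L <+> L')"
    using disj disj[symmetric] unfolding inj_on_def y_def by auto
  have "(\<Sum>a\<in>L <+> L'. scale (ffact (y a) r) (w a)) \<in> N" for r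
  proof -
    obtain c where c: "sigma_rep n \<iota> scale \<rho> (sp_generator n0 \<epsilon> ell (k + int r + int (ell j)) r i j) v =
        (\<Sum>l\<in>L. scale (ffact (y (Inl l)) r) (w (Inl l))) +
        (\<Sum>l\<in>L'. scale (ffact (y (Inr l)) r) (w (Inr l))) + scale c (\<rho> (bvec Kappa0) v)"
      using sigma_rep_generator[of L n k i j v L' ell n0 \<iota> \<epsilon> r] finL n
      unfolding y_def w_def u_def L_def L'_def by auto
    have "sp_generator n0 \<epsilon> ell (k + int r + int (ell j)) r i j \<in> sp_hat n0 \<epsilon> ell"
      unfolding sp_hat_def by (rule P.span_base) (use i j n in blast)
    then have "sigma_rep n \<iota> scale \<rho> (sp_generator n0 \<epsilon> ell (k + int r + int (ell j)) r i j) v \<in> N"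
      using N v unfolding invariant_subspace_def by blast
    from subspace_diff[OF sub this subspace_scale[OF sub kappa, of c]]
    show ?thesis unfolding c by (simp add: sum.Plus finL)
  qed
  from ffact_separation[OF vector_space_axioms sub _ inj this, of "Inl l0"]
  have "w (Inl l0) \<in> N" using finL False by (auto simp: L_def)
  from subspace_scale[OF sub this, of "inverse (ffact (\<iota> - of_int l0) (ell j))"]
  show ?thesis using ffact_nonzero[OF \<iota>] by (simp add: w_def)
qed

text \<open>
  The sum over \<open>l\<close> stays in \<open>N\<close> in any case: it is either a finite sum, or its support is
  infinite and \<open>Sum_any\<close> takes its default value \<open>0\<close>.
\<close>

lemma sp_invariant_if_gl_invariant:
  assumes "invariant_subspace scale UNIV \<rho> N"
  shows "invariant_subspace scale L (sigma_rep n \<iota> scale \<rho>) N"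
proof -
  have sub: "subspace N" and act: "\<And>x v. v \<in> N \<Longrightarrow> \<rho> x v \<in> N"
    using assms by (auto simp: invariant_subspace_def)
  have "sigma_basis n \<iota> scale \<rho> b v \<in> N" if "v \<in> N" for b v
    using that
    by (cases b)
       (auto simp: Sum_any.expand_set subspace_0[OF sub]
          intro!: subspace_add[OF sub] subspace_sum[OF sub] subspace_scale[OF sub] act)
  then show ?thesis
    using sub unfolding invariant_subspace_def sigma_rep_def lin_ext_def
    by (auto intro!: subspace_sum[OF sub] subspace_scale[OF sub])
qed

lemma gl_invariant_if_sp_invariant:
  assumes n: "n = 2 * n0" "n > 0" and \<iota>: "\<forall>k::int. \<iota> \<noteq> of_int k / 2"
    and fin: "\<And>v. \<exists>K. annihilated_from K v"
    and N: "invariant_subspace scale (sp_hat n0 \<epsilon> ell) (sigma_rep n \<iota> scale \<rho>) N"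
  shows "invariant_subspace scale UNIV \<rho> N"
  unfolding invariant_subspace_basis
proof (intro conjI allI ballI)
  show "subspace N" using N by (simp add: invariant_subspace_def)
  fix b v assume v: "v \<in> N"
  interpret P: vector_space "fscale :: complex \<Rightarrow> glh_elem \<Rightarrow> glh_elem" by (rule vector_space_fscale)
  have "bvec Kappa \<in> sp_hat n0 \<epsilon> ell" unfolding sp_hat_def by (rule P.span_base) simp
  then have "sigma_rep n \<iota> scale \<rho> (bvec Kappa) v \<in> N"
    using N v unfolding invariant_subspace_def by blast
  then have kappa: "\<rho> (bvec Kappa0) v \<in> N"
    by (simp add: sigma_rep_def lin_ext_bvec[OF vector_space_axioms])
  show "\<rho> (bvec b) v \<in> N"
  proof (cases b)
    case Kappa0
    then show ?thesis using kappa by simp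
  next
    case (E a c)
    obtain k i j l where "i \<in> {1..n}" "j \<in> {1..n}" "bvec (E a c) = shift_unit n k i j l"
      using every_matrix_unit_is_shift_unit[OF n(2)] by metis
    moreover have "finite {l. \<rho> (shift_unit n k i j l) v \<noteq> 0}" for k i j
      using fin shift_unit_finite n(2) by blast
    ultimately show ?thesis
      using matrix_unit_preserves[OF n(1) _ _ \<iota> _ N v kappa] E by simp
  qed
qed

end

theorem theorem3p4:
  fixes n n0 \<epsilon> m :: nat
    and ell :: "nat \<Rightarrow> nat"
    and \<iota> :: complex
    and scale :: "complex \<Rightarrow> 'v::ab_group_add \<Rightarrow> 'v"
    and \<rho> :: "glt \<Rightarrow> 'v \<Rightarrow> 'v"
    and M0 :: "'v set"
  assumes "n = 2 * n0" and "n > 0"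
    and "\<epsilon> \<in> {0, 1}"
    and "\<forall>i\<in>{1..n}. \<exists>k. ell i = 2 * k + \<epsilon>"
    and "\<forall>i\<in>{1..n}. ell i = ell (n + 1 - i)"
    and "lie_module glt_bracket scale \<rho>"
    and "weighted scale \<rho>"
    and "module.subspace scale M0"
    and "generated_by scale UNIV \<rho> M0"
    and "\<forall>x\<in>glt_above m. \<forall>v\<in>M0. \<rho> x v = 0"
    and "\<forall>k::int. \<iota> \<noteq> of_int k / 2"
  shows "irreducible_rep scale (sp_hat n0 \<epsilon> ell) (sigma_rep n \<iota> scale \<rho>) \<longleftrightarrow>
         irreducible_rep scale UNIV \<rho>"
proof -
  interpret glt_module scale \<rho> by unfold_locales (rule assms)
  have "invariant_subspace scale (sp_hat n0 \<epsilon> ell) (sigma_rep n \<iota> scale \<rho>) N \<longleftrightarrow>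
      invariant_subspace scale UNIV \<rho> N" for N
    using gl_invariant_if_sp_invariant[OF assms(1,2,11) annihilated_from_exists[OF assms(9,10)]]
      sp_invariant_if_gl_invariant by blast
  then show ?thesis by (simp add: irreducible_rep_def)
qed

end
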